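(* Let $p$ be an odd prime number and let $S$ be a zero-sum free sequence of elements of $\mathbb{Z}/p\mathbb{Z}$, of length $|S|$. Then for every positive integer $k$, there is an element of $S$ whose multiplicity in $S$ is at least \[\left\lceil\frac{2}{k}|S|-\frac{2}{k(k+1)}(p-1)\right\rceil.\]
   Context: A sequence $S=(s_1,\dots,s_n)$ in $\mathbb{Z}/p\mathbb{Z}$ (repetitions allowed) has length $|S|=n$; it is zero-sum free if $0\notin\{\sum_{i\in I}s_i:\emptyset\neq I\subset[1,n]\}$. *)

theory Defs
  imports Complex_Main "HOL-Number_Theory.Residues"
begin

definition zero_sum_free :: "('a, 'm) ring_scheme \<Rightarrow> 'a list \<Rightarrow> bool" where
  "zero_sum_free R S \<longleftrightarrow>
     \<zero>\<^bsub>R\<^esub> \<notin> {(\<Oplus>\<^bsub>R\<^esub>i\<in>I. S ! i) | I. I \<noteq> {} \<and> I \<subseteq> {..<length S}}"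

end

theory Submission
  imports Defs "Jordan_Normal_Form.Determinant" "HOL-Computational_Algebra.Formal_Power_Series"
begin

text \<open>
  Split the indices of \<open>S\<close> into classes on which the entries are distinct, one class for each
  possible rank of an entry among its equals; the number of classes is the maximal multiplicity
  \<open>h\<close>. For a class of size \<open>d\<close> the subset sums take at least \<open>1 + d (d + 1) / 2\<close> values mod \<open>p\<close>,
  so the Cauchy-Davenport theorem bounds the sum of the numbers \<open>d (d + 1) / 2\<close> over all classes by
  \<open>p - 1\<close>. Since \<open>(d - k) (d - k - 1) \<ge> 0\<close>, each of them is at least
  \<open>(k + 1) d - k (k + 1) / 2\<close>, and summing over the \<open>h\<close> classes gives the claim.

  The bound for one class is Balandraud's theorem. If \<open>a 0, \<dots>, a (d - 1)\<close> are nonzero and pairwise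
  distinct up to sign, weight the signed sum \<open>L = \<Sum> \<epsilon> i * a i\<close> of a sign vector \<open>\<epsilon>\<close> by \<open>\<Prod> \<epsilon> i\<close> times
  the Vandermonde determinant of the \<open>\<epsilon> i * a i\<close>. The exponential generating function of the weighted
  power sums of \<open>L\<close> is the Wronskian of the functions \<open>2 sinh (a i z)\<close>. It vanishes at \<open>0\<close> to order
  exactly \<open>d (d + 1) / 2\<close>, and its leading coefficient is invertible mod \<open>p\<close>. So no monic polynomial
  of degree \<open>d (d + 1) / 2 < p\<close> can vanish at all \<open>L\<close>. That \<open>d (d + 1) / 2 < p\<close> holds for zero-sum
  free classes follows in the same way from a generalised Vandermonde determinant.
\<close>

section \<open>Determinants\<close>

lemma det_mat_leibniz:
  "det (mat n n (\<lambda>(i,j). f i j)) =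
     (\<Sum>\<pi> | \<pi> permutes {0..<n}. signof \<pi> * (\<Prod>i = 0..<n. f i (\<pi> i)))"
  by (subst det_def'[of _ n]) (auto intro!: sum.cong prod.cong simp: permutes_in_image)

lemma det_mat_cong:
  assumes "\<And>i j. i < n \<Longrightarrow> j < n \<Longrightarrow> f i j = g i j"
  shows "det (mat n n (\<lambda>(i,j). f i j)) = det (mat n n (\<lambda>(i,j). g i j))"
  by (rule arg_cong[of _ _ det]) (auto simp: assms)

lemma det_mat_scale:
  fixes f :: "nat \<Rightarrow> nat \<Rightarrow> 'a :: comm_ring_1"
  shows "det (mat n n (\<lambda>(i,j). u i * v j * f i j)) =
     prod u {0..<n} * prod v {0..<n} * det (mat n n (\<lambda>(i,j). f i j))"
proof -
  have "(\<Prod>i = 0..<n. v (\<pi> i)) = prod v {0..<n}" if "\<pi> permutes {0..<n}" for \<pi>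
    using prod.permute[OF that, of v] by (simp add: o_def)
  then show ?thesis
    by (simp add: det_mat_leibniz prod.distrib sum_distrib_left mult_ac)
qed

lemma det_mat_mult:
  fixes f g :: "nat \<Rightarrow> nat \<Rightarrow> 'a :: comm_ring_1"
  shows "det (mat n n (\<lambda>(i,j). \<Sum>k = 0..<n. f i k * g k j)) =
     det (mat n n (\<lambda>(i,j). f i j)) * det (mat n n (\<lambda>(i,j). g i j))"
proof -
  have "mat n n (\<lambda>(i,j). \<Sum>k = 0..<n. f i k * g k j) =
      mat n n (\<lambda>(i,j). f i j) * mat n n (\<lambda>(i,j). g i j)"
    by (rule eq_matI) (auto simp: scalar_prod_def intro!: sum.cong)
  then show ?thesis by (simp add: det_mult[of _ n])
qed

lemma det_mat_upper:
  assumes "\<And>i j. j < i \<Longrightarrow> i < n \<Longrightarrow> f i j = 0"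
  shows "det (mat n n (\<lambda>(i,j). f i j)) = (\<Prod>i = 0..<n. f i i)"
  by (subst det_upper_triangular[of _ n])
     (auto simp: assms prod_list_diag_prod upper_triangular_def intro!: prod.cong)

lemma det_mat_lower:
  assumes "\<And>i j. i < j \<Longrightarrow> j < n \<Longrightarrow> f i j = 0"
  shows "det (mat n n (\<lambda>(i,j). f i j)) = (\<Prod>i = 0..<n. f i i)"
  by (subst det_lower_triangular[of n])
     (auto simp: assms prod_list_diag_prod intro!: prod.cong)

section \<open>Weighted power sums of the signed sums\<close>

text \<open>A sign vector is encoded by the set of positions carrying +1. The ring is generic
  because the same moments are computed over the reals and then read as integers modulo p.\<close>

definition sign_of :: "nat set \<Rightarrow> nat \<Rightarrow> 'a :: comm_ring_1" where
  "sign_of I i = (if i \<in> I then 1 else - 1)"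

definition signed_sum :: "nat \<Rightarrow> (nat \<Rightarrow> 'a :: comm_ring_1) \<Rightarrow> nat set \<Rightarrow> 'a" where
  "signed_sum d a I = (\<Sum>i = 0..<d. sign_of I i * a i)"

text \<open>A generalised Vandermonde determinant; the exponents \<open>r j = j\<close> give the
  ordinary one.\<close>

definition alternant :: "nat \<Rightarrow> (nat \<Rightarrow> 'a :: comm_ring_1) \<Rightarrow> (nat \<Rightarrow> nat) \<Rightarrow> 'a" where
  "alternant d x r = det (mat d d (\<lambda>(i,j). x i ^ r j))"

definition weight :: "nat \<Rightarrow> (nat \<Rightarrow> 'a :: comm_ring_1) \<Rightarrow> (nat \<Rightarrow> nat) \<Rightarrow> nat set \<Rightarrow> 'a" where
  "weight d a r I = (\<Prod>i = 0..<d. sign_of I i) * alternant d (\<lambda>i. sign_of I i * a i) r"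

definition moment :: "nat \<Rightarrow> (nat \<Rightarrow> 'a :: comm_ring_1) \<Rightarrow> (nat \<Rightarrow> nat) \<Rightarrow> nat \<Rightarrow> 'a" where
  "moment d a r m = (\<Sum>I\<in>Pow {0..<d}. weight d a r I * signed_sum d a I ^ m)"

lemma of_int_sign_of: "of_int (sign_of I i) = sign_of I i"
  by (simp add: sign_of_def)

lemma of_int_alternant: "of_int (alternant d x r) = alternant d (\<lambda>i. of_int (x i)) r"
  by (simp add: alternant_def det_mat_leibniz sign_def flip: of_int_power)

lemma of_int_moment: "of_int (moment d a r m) = moment d (\<lambda>i. of_int (a i)) r m"
  by (simp add: moment_def weight_def signed_sum_def of_int_alternant of_int_sign_of)

text \<open>Expand the product: each factor contributes its term at 1 or at -1, and \<open>I\<close>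
  records where 1 was chosen. \<open>F\<close> takes the sign as a ring element so that it can sit
  inside powers and exponentials.\<close>

lemma prod_diff_sign_of:
  fixes F :: "nat \<Rightarrow> 'b :: comm_ring_1 \<Rightarrow> 'a :: comm_ring_1"
  assumes "finite A"
  shows "(\<Prod>i\<in>A. F i 1 - F i (- 1)) =
    (\<Sum>I\<in>Pow A. (\<Prod>i\<in>A. sign_of I i) * (\<Prod>i\<in>A. F i (sign_of I i)))"
proof -
  have "(\<Prod>i\<in>A. F i 1 - F i (- 1)) = (\<Prod>i\<in>A. F i 1 + - F i (- 1))" by simp
  also have "\<dots> = (\<Sum>I\<in>Pow A. (\<Prod>i\<in>I. F i 1) * (\<Prod>i\<in>A - I. - F i (- 1)))"
    by (rule prod_add[OF assms])
  also have "\<dots> = (\<Sum>I\<in>Pow A. \<Prod>i\<in>A. sign_of I i * F i (sign_of I i))"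
  proof (rule sum.cong[OF refl])
    fix I assume I: "I \<in> Pow A"
    have "(\<Prod>i\<in>A. sign_of I i * F i (sign_of I i)) =
        (\<Prod>i\<in>A - I. sign_of I i * F i (sign_of I i)) * (\<Prod>i\<in>I. sign_of I i * F i (sign_of I i))"
      using I assms by (intro prod.subset_diff) auto
    also have "(\<Prod>i\<in>A - I. sign_of I i * F i (sign_of I i)) = (\<Prod>i\<in>A - I. - F i (- 1))"
      by (rule prod.cong) (auto simp: sign_of_def)
    also have "(\<Prod>i\<in>I. sign_of I i * F i (sign_of I i)) = (\<Prod>i\<in>I. F i 1)"
      by (rule prod.cong) (auto simp: sign_of_def)
    finally show "(\<Prod>i\<in>I. F i 1) * (\<Prod>i\<in>A - I. - F i (- 1)) =
        (\<Prod>i\<in>A. sign_of I i * F i (sign_of I i))" by (simp add: mult.commute)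
  qed
  finally show ?thesis by (simp add: prod.distrib)
qed

section \<open>Exponential generating functions of the moments\<close>

lemma prod_fps_exp:
  fixes c :: "'b \<Rightarrow> 'a :: field_char_0"
  shows "finite A \<Longrightarrow> (\<Prod>i\<in>A. fps_exp (c i)) = fps_exp (\<Sum>i\<in>A. c i)"
  by (induction A rule: finite_induct) (auto simp: fps_exp_add_mult)

lemma prod_fps_const: "finite A \<Longrightarrow> (\<Prod>i\<in>A. fps_const (c i)) = fps_const (\<Prod>i\<in>A. c i)"
  by (induction A rule: finite_induct) auto

lemma fps_const_sign_of: "fps_const (sign_of I i) = sign_of I i"
  by (simp add: sign_of_def flip: fps_const_neg)

text \<open>The \<open>r j\<close>-th derivative of \<open>2 sinh (a i z)\<close>.\<close>

definition exp_mat :: "(nat \<Rightarrow> real) \<Rightarrow> (nat \<Rightarrow> nat) \<Rightarrow> nat \<Rightarrow> nat \<Rightarrow> real fps" where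
  "exp_mat a r i j = fps_const (a i ^ r j) * fps_exp (a i)
      - fps_const ((- a i) ^ r j) * fps_exp (- a i)"

text \<open>In the Leibniz expansion each row is a difference over the two signs. For a fixed sign
  vector the exponentials multiply to \<open>fps_exp (signed_sum d a I)\<close>, and the powers,
  summed over permutations, form the alternant in \<open>weight\<close>.\<close>

lemma moment_egf:
  "moment d a r m = fact m * fps_nth (det (mat d d (\<lambda>(i,j). exp_mat a r i j))) m"
proof -
  define x where "x I i = sign_of I i * a i" for I i
  have "det (mat d d (\<lambda>(i,j). exp_mat a r i j)) =
      (\<Sum>\<pi> | \<pi> permutes {0..<d}. signof \<pi> * (\<Sum>I\<in>Pow {0..<d}. (\<Prod>i = 0..<d. sign_of I i) *
        (\<Prod>i = 0..<d. fps_const (x I i ^ r (\<pi> i)) * fps_exp (x I i))))"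
    unfolding det_mat_leibniz exp_mat_def x_def
    by (intro sum.cong refl arg_cong2[of _ _ _ _ "(*)"],
        subst prod_diff_sign_of[symmetric, where F = "\<lambda>i s. fps_const ((s * a i) ^ r (_ i)) * fps_exp (s * a i)"])
       simp_all
  also have "\<dots> = (\<Sum>\<pi> | \<pi> permutes {0..<d}. \<Sum>I\<in>Pow {0..<d}. 
      fps_const (signof \<pi> * (\<Prod>i = 0..<d. sign_of I i) * (\<Prod>i = 0..<d. x I i ^ r (\<pi> i))) * 
        fps_exp (signed_sum d a I))"
    unfolding sum_distrib_left
    by (intro sum.cong refl)
      (simp add: prod.distrib prod_fps_exp prod_fps_const signed_sum_def x_def sign_def 
         flip: fps_const_sign_of fps_const_mult fps_const_neg)
  also have "\<dots> = (\<Sum>I\<in>Pow {0..<d}. \<Sum>\<pi> | \<pi> permutes {0..<d}.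
      fps_const (signof \<pi> * (\<Prod>i = 0..<d. sign_of I i) * (\<Prod>i = 0..<d. x I i ^ r (\<pi> i))) * 
        fps_exp (signed_sum d a I))"
    by (rule sum.swap)
  finally have "fact m * fps_nth (det (mat d d (\<lambda>(i,j). exp_mat a r i j))) m = 
     (\<Sum>I\<in>Pow {0..<d}. \<Sum>\<pi> | \<pi> permutes {0..<d}.
      signof \<pi> * (\<Prod>i = 0..<d. sign_of I i) * (\<Prod>i = 0..<d. x I i ^ r (\<pi> i)) * signed_sum d a I ^ m)"
    by (simp add: fps_sum_nth sum_distrib_left)
  also have "\<dots> = moment d a r m"
    unfolding moment_def weight_def alternant_def det_mat_leibniz x_def
    by (intro sum.cong refl) (simp add: sum_distrib_left sum_distrib_right mult_ac)
  finally show ?thesis ..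
qed

text \<open>The falling factorial, the factor produced by differentiating z^n r times. It is 0 for r
  > n, so low coefficients obey the same formula as the others.\<close>

definition ffact :: "nat \<Rightarrow> nat \<Rightarrow> nat" where
  "ffact n r = (n choose r) * fact r"

lemma ffact_div_fact: "r \<le> n \<Longrightarrow> real (ffact n r) / fact n = 1 / fact (n - r)"
  by (simp add: ffact_def binomial_fact)

text \<open>Multiplying the r-th derivative by z^r restores the power of z and leaves a falling
  factorial; the difference of the two exponentials kills the even powers.\<close>

lemma exp_mat_nth:
  "fps_nth (fps_X ^ r j * exp_mat a r i j) n =
     real (ffact n (r j)) / fact n * (1 - (- 1) ^ n) * a i ^ n"
proof (cases "n < r j")
  case True
  then show ?thesis by (simp add: fps_X_power_mult_nth ffact_def)
next
  case False
  then have r: "r j \<le> n" by simp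
  have *: "x ^ r j * (x ^ (n - r j) / fact (n - r j)) = real (ffact n (r j)) / fact n * x ^ n" for x :: real
    using r by (simp add: ffact_div_fact flip: power_add)
  have "(- a i) ^ n = (- 1) ^ n * a i ^ n"
    by (metis mult_minus1 power_mult_distrib)
  moreover have "fps_nth (fps_X ^ r j * exp_mat a r i j) n =
      a i ^ r j * (a i ^ (n - r j) / fact (n - r j)) -
      (- a i) ^ r j * ((- a i) ^ (n - r j) / fact (n - r j))"
    using r unfolding fps_X_power_mult_nth exp_mat_def by simp
  ultimately show ?thesis
    unfolding * by (simp add: algebra_simps diff_divide_distrib)
qed

section \<open>Determinants of power series and their order of vanishing\<close>

lemma fps_nth_0_prod: "finite A \<Longrightarrow> fps_nth (\<Prod>i\<in>A. f i) 0 = (\<Prod>i\<in>A. fps_nth (f i) 0)"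
  by (induction A rule: finite_induct) auto

lemma fps_nth_0_of_int: "fps_nth (of_int k) 0 = of_int k"
  by (simp flip: fps_of_int)

lemma fps_nth_0_det:
  "fps_nth (det (mat n n (\<lambda>(i,j). f i j))) 0 = det (mat n n (\<lambda>(i,j). fps_nth (f i j) 0))"
  by (simp add: det_mat_leibniz fps_sum_nth fps_nth_0_prod fps_nth_0_of_int)

lemma sum_fps_const: "(\<Sum>i\<in>A. fps_const (c i)) = fps_const (\<Sum>i\<in>A. c i)"
  by (induction A rule: infinite_finite_induct) auto

lemma det_fps_const:
  "det (mat n n (\<lambda>(i,j). fps_const (f i j))) = fps_const (det (mat n n (\<lambda>(i,j). f i j)))"
  by (simp add: det_mat_leibniz prod_fps_const flip: fps_of_int sum_fps_const)

lemma sum_odd_upto: "(\<Sum>k = 0..<d. 2 * k + 1) = (d::nat)\<^sup>2"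
  by (induction d) (auto simp: power2_eq_square)

lemma left_inverse_exists:
  fixes f :: "nat \<Rightarrow> nat \<Rightarrow> real"
  assumes "det (mat n n (\<lambda>(i,j). f i j)) \<noteq> 0"
  obtains c where "\<And>k l. k < n \<Longrightarrow> l < n \<Longrightarrow> (\<Sum>i = 0..<n. c k i * f i l) = (if k = l then 1 else 0)"
proof -
  let ?A = "mat n n (\<lambda>(i,j). f i j)"
  have "?A \<in> Units (ring_mat TYPE(real) n ())"
    using assms by (intro det_non_zero_imp_unit) auto
  then obtain C where C: "C \<in> carrier_mat n n" "C * ?A = 1\<^sub>m n"
    by (auto simp: Units_def ring_mat_simps)
  show thesis
  proof (rule that[of "\<lambda>k i. C $$ (k, i)"])
    fix k l assume kl: "k < n" "l < n"
    have "(\<Sum>i = 0..<n. C $$ (k, i) * f i l) = (C * ?A) $$ (k, l)"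
      using kl C(1) by (auto simp: scalar_prod_def intro!: sum.cong)
    then show "(\<Sum>i = 0..<n. C $$ (k, i) * f i l) = (if k = l then 1 else 0)"
      using C(2) kl by simp
  qed
qed

text \<open>
  The matrix \<open>c\<close> combines the rows \<open>2 sinh (a i z)\<close> so that the \<open>k\<close>-th one becomes
  \<open>2 z ^ (2 k + 1) / (2 k + 1)! + O(z ^ (2 d + 1))\<close>. The \<open>j\<close>-th column is multiplied by \<open>z ^ r j\<close>
  to avoid negative exponents.
\<close>

lemma moment_low_order:
  fixes a :: "nat \<Rightarrow> real" and d :: nat
  defines "W \<equiv> alternant d a (\<lambda>k. 2 * k + 1)"
  assumes W: "W \<noteq> 0"
  shows moment_below: "m + sum r {0..<d} < d\<^sup>2 \<Longrightarrow> moment d a r m = 0"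
    and moment_leading: "m + sum r {0..<d} = d\<^sup>2 \<Longrightarrow>
      moment d a r m * (\<Prod>k = 0..<d. fact (2 * k + 1)) =
      fact m * 2 ^ d * W * det (mat d d (\<lambda>(k,j). real (ffact (2 * k + 1) (r j))))"
proof -
  \<comment> \<open>\<open>c\<close> inverts the matrix of odd powers of the \<open>a i\<close>,
    which up to constant factors are the Taylor coefficients of the rows.\<close>
  obtain c where c: "\<And>k l. k < d \<Longrightarrow> l < d \<Longrightarrow>
      (\<Sum>i = 0..<d. c k i * a i ^ (2 * l + 1)) = (if k = l then 1 else 0)"
    using left_inverse_exists W unfolding W_def alternant_def by blast
  define D where "D = det (mat d d (\<lambda>(k,i). c k i))"
  have "D * W = det (mat d d (\<lambda>(k,l). \<Sum>i = 0..<d. c k i * a i ^ (2 * l + 1)))"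
    unfolding D_def W_def alternant_def by (rule det_mat_mult[symmetric])
  also have "\<dots> = det (mat d d (\<lambda>(k,l). if k = l then 1 else 0))"
    by (rule det_mat_cong) (rule c)
  also have "\<dots> = 1" by (subst det_mat_upper) auto
  finally have DW: "D * W = 1" .
  define R where "R = sum r {0..<d}"
  define E where "E k j = (\<Sum>i = 0..<d. fps_const (c k i) * (fps_X ^ r j * exp_mat a r i j))" for k j
  have E_nth: "fps_nth (E k j) n = real (ffact n (r j)) / fact n * (1 - (- 1) ^ n) *
      (\<Sum>i = 0..<d. c k i * a i ^ n)" for k j n
    by (simp add: E_def fps_sum_nth exp_mat_nth sum_distrib_left sum_divide_distrib mult_ac)
  define H where "H k j = fps_shift (2 * k + 1) (E k j)" for k j
  have E_eq: "E k j = fps_X ^ (2 * k + 1) * H k j" if "k < d" for k j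
  proof (rule fps_ext)
    fix n
    \<comment> \<open>Even coefficients vanish by parity, odd ones below 2k+1 by the choice of
      \<open>c\<close>.\<close>
    have "fps_nth (E k j) n = 0" if "n < 2 * k + 1"
    proof (cases "even n")
      case False
      then obtain l where "n = 2 * l + 1" by (elim oddE)
      then show ?thesis using c[of k l] that \<open>k < d\<close> by (simp add: E_nth)
    qed (simp add: E_nth)
    then show "fps_nth (E k j) n = fps_nth (fps_X ^ (2 * k + 1) * H k j) n"
      unfolding fps_X_power_mult_nth H_def by simp
  qed
  have H0: "fps_nth (H k j) 0 = 2 / fact (2 * k + 1) * 1 * real (ffact (2 * k + 1) (r j))" if "k < d" for k j
    using c[OF that that] by (simp add: H_def E_nth)
  have "det (mat d d (\<lambda>(k,j). E k j)) =
      fps_const D * det (mat d d (\<lambda>(i,j). fps_X ^ r j * exp_mat a r i j))"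
    unfolding E_def det_mat_mult det_fps_const D_def ..
  also have "det (mat d d (\<lambda>(i,j). fps_X ^ r j * exp_mat a r i j)) =
      fps_X ^ R * det (mat d d (\<lambda>(i,j). exp_mat a r i j))"
    using det_mat_scale[of d "\<lambda>_. 1" "\<lambda>j. fps_X ^ r j" "exp_mat a r"]
    by (simp add: R_def power_sum)
  finally have "fps_const D * (fps_X ^ R * det (mat d d (\<lambda>(i,j). exp_mat a r i j))) =
      det (mat d d (\<lambda>(k,j). E k j))" ..
  also have "\<dots> = det (mat d d (\<lambda>(k,j). fps_X ^ (2 * k + 1) * 1 * H k j))"
    by (rule det_mat_cong) (simp add: E_eq)
  also have "\<dots> = fps_X ^ (d\<^sup>2) * det (mat d d (\<lambda>(k,j). H k j))"
    unfolding det_mat_scale by (simp only: sum_odd_upto flip: power_sum) simp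
  finally have eq: "fps_const D * (fps_X ^ R * det (mat d d (\<lambda>(i,j). exp_mat a r i j))) =
      fps_X ^ (d\<^sup>2) * det (mat d d (\<lambda>(k,j). H k j))" .
  \<comment> \<open>Compare coefficients of z^(m + R). The right side starts at z^(d^2), since 1 + 3
    + ... + (2d - 1) = d^2.\<close>
  have "D * fps_nth (det (mat d d (\<lambda>(i,j). exp_mat a r i j))) m =
      (if m + R < d\<^sup>2 then 0 else fps_nth (det (mat d d (\<lambda>(k,j). H k j))) (m + R - d\<^sup>2))"
    using arg_cong[OF eq, of "\<lambda>f. fps_nth f (m + R)"] by (simp add: fps_X_power_mult_nth)
  then have key: "D * moment d a r m = fact m *
      (if m + R < d\<^sup>2 then 0 else fps_nth (det (mat d d (\<lambda>(k,j). H k j))) (m + R - d\<^sup>2))"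
    by (simp add: moment_egf algebra_simps)
  show "moment d a r m = 0" if "m + sum r {0..<d} < d\<^sup>2"
    using key that DW by (auto simp: R_def)
  show "moment d a r m * (\<Prod>k = 0..<d. fact (2 * k + 1)) =
      fact m * 2 ^ d * W * det (mat d d (\<lambda>(k,j). real (ffact (2 * k + 1) (r j))))"
    if "m + sum r {0..<d} = d\<^sup>2"
  proof -
    let ?F = "det (mat d d (\<lambda>(k,j). real (ffact (2 * k + 1) (r j))))"
    let ?P = "\<Prod>k = 0..<d. fact (2 * k + 1) :: real"
    have "fps_nth (det (mat d d (\<lambda>(k,j). H k j))) 0 =
        det (mat d d (\<lambda>(k,j). 2 / fact (2 * k + 1) * 1 * real (ffact (2 * k + 1) (r j))))"
      unfolding fps_nth_0_det by (rule det_mat_cong) (rule H0)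
    also have "\<dots> = 2 ^ d / ?P * ?F"
      unfolding det_mat_scale by (simp add: prod_dividef)
    finally have "D * moment d a r m = fact m * (2 ^ d / ?P * ?F)"
      using key that by (simp add: R_def)
    moreover have "(D * W) * moment d a r m = W * (D * moment d a r m)" by (simp only: mult_ac)
    ultimately have "moment d a r m = W * (fact m * (2 ^ d / ?P * ?F))" unfolding DW by simp
    moreover have "?P \<noteq> 0" by (simp add: prod_zero_iff)
    moreover have "M * P = f * t * W * F" if "M = W * (f * (t / P * F))" "P \<noteq> 0"
      for M P F f t :: real using that by (simp add: field_simps)
    ultimately show ?thesis by blast
  qed
qed

section \<open>Evaluation of the leading coefficient\<close>

lemma monom_altdef_1: "monom 1 n = [:0, 1:] ^ n"
  by (simp add: monom_altdef)

lemma coeff_binomial_power: "coeff ([:c, 1:] ^ n) i = of_nat (n choose i) * (c :: int) ^ (n - i)"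
proof (cases "i \<le> n")
  case True
  then show ?thesis by (simp add: coeff_linear_poly_power)
next
  case False
  have "degree ([:c, 1:] ^ n) = n" by (simp add: degree_power_eq)
  then show ?thesis using False by (simp add: coeff_eq_0 binomial_eq_0)
qed

text \<open>After transposing, unitriangular row operations replace the powers of x^s by the Newton
  polynomials \<open>N k\<close>, monic of degree k and vanishing at \<open>a l ^ s\<close> for l <
  k. The matrix becomes upper triangular.\<close>

lemma alternant_arith_progression:
  fixes a :: "nat \<Rightarrow> int"
  shows "alternant d a (\<lambda>k. s * k + e) =
    (\<Prod>k = 0..<d. a k ^ e * (\<Prod>l = 0..<k. a k ^ s - a l ^ s))"
proof -
  define N where "N k = (\<Prod>l = 0..<k. [:- (a l ^ s), 1:])" for k
  have degree: "degree (N k) = k" for k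
    unfolding N_def by (subst degree_prod_eq_sum_degree) auto
  have lead: "coeff (N k) k = 1" for k
    using lead_coeff_prod[of "\<lambda>l. [:- (a l ^ s), 1:]" "{0..<k}"] degree[of k] by (simp add: N_def)
  have eval: "(\<Sum>l = 0..<d. coeff (N k) l * x ^ l) = poly (N k) x" if "k < d" for k x
  proof -
    have "poly (N k) x = (\<Sum>l\<le>k. coeff (N k) l * x ^ l)"
      by (simp add: poly_altdef degree)
    also have "\<dots> = (\<Sum>l = 0..<d. coeff (N k) l * x ^ l)"
      using that by (intro sum.mono_neutral_left) (auto simp: coeff_eq_0 degree)
    finally show ?thesis ..
  qed
  have "alternant d a (\<lambda>k. s * k + e) = det (mat d d (\<lambda>(l,i). a i ^ (s * l + e)))"
    unfolding alternant_def by (subst det_transpose[symmetric, of _ d])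
      (auto intro!: arg_cong[of _ _ det])
  also have "\<dots> = det (mat d d (\<lambda>(k,l). coeff (N k) l)) * det (mat d d (\<lambda>(l,i). a i ^ (s * l + e)))"
    by (subst det_mat_lower) (auto simp: lead coeff_eq_0 degree)
  also have "\<dots> = det (mat d d (\<lambda>(k,i). \<Sum>l = 0..<d. coeff (N k) l * a i ^ (s * l + e)))"
    by (rule det_mat_mult[symmetric])
  also have "\<dots> = det (mat d d (\<lambda>(k,i). a i ^ e * poly (N k) (a i ^ s)))"
  proof (rule det_mat_cong)
    fix k i assume "k < d" "i < d"
    then show "(\<Sum>l = 0..<d. coeff (N k) l * a i ^ (s * l + e)) = a i ^ e * poly (N k) (a i ^ s)"
      by (simp add: eval[symmetric] sum_distrib_left power_mult[symmetric] power_add mult_ac)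
  qed
  also have "\<dots> = (\<Prod>k = 0..<d. a k ^ e * poly (N k) (a k ^ s))"
    by (rule det_mat_upper) (auto simp: N_def poly_prod prod_zero_iff)
  finally show ?thesis by (simp add: N_def poly_prod)
qed

text \<open>Raising the last exponent by q lowers the index of the leading moment from
  \<open>triangle d\<close> to \<open>triangle d - q\<close>, so it can be moved to p - 1.\<close>

definition bump :: "nat \<Rightarrow> nat \<Rightarrow> nat \<Rightarrow> nat" where
  "bump d q j = (if Suc j = d then j + q else j)"

lemma bump_0: "bump d 0 = (\<lambda>j. j)"
  by (simp add: bump_def fun_eq_iff)

definition triangle :: "nat \<Rightarrow> nat" where
  "triangle n = n * (n + 1) div 2"

lemma sum_bump: "d > 0 \<Longrightarrow> sum (bump d q) {0..<d} + triangle d = d\<^sup>2 + q"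
proof -
  assume "d > 0"
  then obtain e where e: "d = Suc e" by (cases d) auto
  have "sum (bump d q) {0..<e} = \<Sum>{0..<e}"
    by (rule sum.cong) (auto simp: bump_def e)
  then have "sum (bump d q) {0..<d} = \<Sum>{0..<d} + q"
    unfolding e by (simp add: bump_def)
  moreover have "\<Sum>{0..<d} + triangle d = d\<^sup>2"
    by (induction d) (auto simp: power2_eq_square triangle_def)
  ultimately show ?thesis by simp
qed

text \<open>Arises in the last diagonal entry of the triangular matrix in \<open>det_ffact\<close>;
  it is the one factor there whose prime divisors are not evident.\<close>

definition hook_coeff :: "nat \<Rightarrow> nat \<Rightarrow> int" where
  "hook_coeff d q = coeff ([:1, 1:] * [:2, 1:] ^ (d - 1)) q"

text \<open>Makes the prime divisors of the coefficient visible. The proof uses Pascal's rule and d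
  * C(d-1, q-1) = q * C(d, q).\<close>

lemma hook_coeff_eq:
  assumes "d > 0" "q \<le> d"
  shows "2 ^ (q + 1) * int d * hook_coeff d q = 2 ^ d * int (d + q) * int (d choose q)"
proof -
  obtain e where e: "d = Suc e" using assms by (cases d) auto
  show ?thesis
  proof (cases q)
    case 0
    then show ?thesis by (simp add: hook_coeff_def e coeff_binomial_power)
  next
    case (Suc s)
    then have s: "s \<le> e" using assms e by simp
    \<comment> \<open>For s = e the subtraction truncates, but then the binomial coefficient is
      0.\<close>
    have "2 ^ (s + 1) * (int (e choose Suc s) * 2 ^ (e - Suc s)) = 2 ^ e * int (e choose Suc s)"
    proof (cases "s = e")
      case False
      then have "s + 1 + (e - Suc s) = e" using s by simp
      then have "2 ^ (s + 1) * (2 :: int) ^ (e - Suc s) = 2 ^ e" by (simp only: flip: power_add)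
      then show ?thesis by (simp add: mult_ac)
    qed simp
    moreover have "2 ^ s * (int (e choose s) * 2 ^ (e - s)) = 2 ^ e * int (e choose s)"
      using s by (auto simp flip: power_add)
    moreover have "2 ^ (s + 1) * hook_coeff d q =
        2 ^ (s + 1) * (int (e choose Suc s) * 2 ^ (e - Suc s)) +
        2 * (2 ^ s * (int (e choose s) * 2 ^ (e - s)))"
      by (simp add: hook_coeff_def e Suc coeff_binomial_power algebra_simps)
    ultimately have "2 ^ (s + 1) * hook_coeff d q =
        2 ^ e * (int (e choose Suc s) + 2 * int (e choose s))"
      by (simp only: algebra_simps)
    also have "int (e choose Suc s) + 2 * int (e choose s) = int (d choose q) + int (e choose s)"
      by (simp add: e Suc)
    finally have h: "2 ^ (s + 1) * hook_coeff d q = 2 ^ e * (int (d choose q) + int (e choose s))" .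
    have "2 ^ (q + 1) * int d * hook_coeff d q = 2 * int d * (2 ^ (s + 1) * hook_coeff d q)"
      by (simp add: Suc)
    also have "\<dots> = 2 ^ d * (int d * int (d choose q) + int d * int (e choose s))"
      unfolding h by (simp only: e power_Suc) (simp only: algebra_simps)
    also have "int d * int (e choose s) = int q * int (d choose q)"
      using Suc_times_binomial[of s e] unfolding e Suc by (simp only: flip: of_nat_mult)
    finally show ?thesis by (simp add: algebra_simps)
  qed
qed

text \<open>Up to a factorial depending on the column, row k lists coefficients of (1 + x)^(2k+1).
  Unitriangular finite differences in k turn these polynomials into (1 + x) ((1 + x)^2 - 1)^l = x^l
  (1 + x) (2 + x)^l, which have no terms below x^l.\<close>

lemma det_ffact:
  assumes "d > 0"
  shows "det (mat d d (\<lambda>(k,j). int (ffact (2 * k + 1) (bump d q j)))) =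
     (\<Prod>j = 0..<d - 1. fact j * 2 ^ j) * fact (d - 1 + q) * hook_coeff d q"
proof -
  let ?F = "\<lambda>k j. int (ffact (2 * k + 1) (bump d q j))"
  have entry: "(\<Sum>k = 0..<d. ((- 1) ^ (l - k) * int (l choose k)) * ?F k j) =
      fact (bump d q j) * coeff ([:0, 1:] ^ l * ([:1, 1:] * [:2, 1:] ^ l)) (bump d q j)" if "l < d" for l j
  proof -
    have "[:1, 1:]\<^sup>2 + (- 1) = [:0, 1:] * [:2, 1 :: int:]"
      by (simp add: power2_eq_square one_pCons)
    then have "[:0, 1:] ^ l * ([:1, 1:] * [:2, 1:] ^ l) = [:1, 1:] * ([:1, 1 :: int:]\<^sup>2 + (- 1)) ^ l"
      by (simp only: power_mult_distrib mult_ac)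
    also have "([:1, 1 :: int:]\<^sup>2 + (- 1)) ^ l =
        (\<Sum>k\<le>l. of_nat (l choose k) * ([:1, 1:]\<^sup>2) ^ k * (- 1) ^ (l - k))"
      by (rule binomial_ring)
    also have "[:1, 1:] * \<dots> =
        (\<Sum>k\<le>l. smult ((- 1) ^ (l - k) * int (l choose k)) ([:1, 1:] ^ (2 * k + 1)))"
      unfolding sum_distrib_left
    proof (rule sum.cong[OF refl])
      fix k
      have "(- 1 :: int poly) ^ (l - k) = [:(- 1) ^ (l - k):]"
        using poly_const_pow[of "- 1 :: int"] by (simp add: one_pCons)
      then show "[:1, 1:] * (of_nat (l choose k) * ([:1, 1:]\<^sup>2) ^ k * (- 1) ^ (l - k)) =
          smult ((- 1) ^ (l - k) * int (l choose k)) ([:1, 1:] ^ (2 * k + 1))"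
        by (simp add: power_mult[symmetric] of_nat_poly mult_ac)
    qed
    finally have "coeff ([:0, 1:] ^ l * ([:1, 1:] * [:2, 1:] ^ l)) (bump d q j) =
        (\<Sum>k\<le>l. (- 1) ^ (l - k) * int (l choose k) * int ((2 * k + 1) choose bump d q j))"
      by (simp add: coeff_sum coeff_binomial_power del: power_Suc)
    also have "\<dots> = (\<Sum>k = 0..<d. (- 1) ^ (l - k) * int (l choose k) * int ((2 * k + 1) choose bump d q j))"
      using that by (intro sum.mono_neutral_left) (auto simp: binomial_eq_0)
    finally show ?thesis by (simp add: ffact_def sum_distrib_left mult_ac)
  qed
  have "det (mat d d (\<lambda>(k,j). ?F k j)) =
      det (mat d d (\<lambda>(l,k). (- 1) ^ (l - k) * int (l choose k))) * det (mat d d (\<lambda>(k,j). ?F k j))"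
    by (subst det_mat_lower) (auto simp: binomial_eq_0)
  also have "\<dots> = det (mat d d (\<lambda>(l,j). \<Sum>k = 0..<d. ((- 1) ^ (l - k) * int (l choose k)) * ?F k j))"
    by (rule det_mat_mult[symmetric])
  also have "\<dots> = det (mat d d (\<lambda>(l,j). fact (bump d q j) *
      coeff ([:0, 1:] ^ l * ([:1, 1:] * [:2, 1:] ^ l)) (bump d q j)))"
    by (rule det_mat_cong) (rule entry)
  also have "\<dots> = (\<Prod>l = 0..<d. fact (bump d q l) *
      coeff ([:0, 1:] ^ l * ([:1, 1:] * [:2, 1:] ^ l)) (bump d q l))"
    \<comment> \<open>The raised exponent is in the last column, where nothing lies below the
      diagonal.\<close>
    by (rule det_mat_upper) (auto simp: bump_def coeff_monom_mult simp flip: monom_altdef_1)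
  also have "\<dots> = (\<Prod>l = 0..<d - 1. fact l * 2 ^ l) * (fact (d - 1 + q) * hook_coeff d q)"
  proof -
    obtain e where e: "d = Suc e" using assms by (cases d) auto
    have "(\<Prod>l = 0..<e. fact (bump d q l) *
        coeff ([:0, 1:] ^ l * ([:1, 1:] * [:2, 1:] ^ l)) (bump d q l)) = (\<Prod>l = 0..<e. fact l * (2 ^ l :: int))"
    proof (rule prod.cong[OF refl])
      fix l assume "l \<in> {0..<e}"
      then have "bump d q l = l" by (simp add: bump_def e)
      then show "fact (bump d q l) * coeff ([:0, 1:] ^ l * ([:1, 1:] * [:2, 1:] ^ l)) (bump d q l) =
          fact l * (2 ^ l :: int)"
        by (simp add: coeff_monom_mult coeff_binomial_power flip: monom_altdef_1)
    qed
    then show ?thesis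
      by (simp add: e bump_def hook_coeff_def coeff_monom_mult flip: monom_altdef_1)
  qed
  finally show ?thesis by simp
qed

section \<open>Subset sums of a set modulo a prime\<close>

text \<open>The exponential series and the inverse matrix live over the reals; both sides are
  integers, so the identities descend along the injective \<open>of_int\<close>.\<close>

lemma moment_int:
  fixes a :: "nat \<Rightarrow> int" and d :: nat
  assumes W: "alternant d a (\<lambda>k. 2 * k + 1) \<noteq> 0"
  shows moment_int_below: "m + sum r {0..<d} < d\<^sup>2 \<Longrightarrow> moment d a r m = 0"
    and moment_int_leading: "m + sum r {0..<d} = d\<^sup>2 \<Longrightarrow>
      moment d a r m * (\<Prod>k = 0..<d. fact (2 * k + 1)) =
      fact m * 2 ^ d * alternant d a (\<lambda>k. 2 * k + 1) *
        det (mat d d (\<lambda>(k,j). int (ffact (2 * k + 1) (r j))))"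
proof -
  have W': "alternant d (\<lambda>i. real_of_int (a i)) (\<lambda>k. 2 * k + 1) \<noteq> 0"
    using W by (simp flip: of_int_alternant)
  show "moment d a r m = 0" if "m + sum r {0..<d} < d\<^sup>2"
    using moment_below[OF W' that] by (simp flip: of_int_moment)
  have det: "det (mat d d (\<lambda>(k,j). real (ffact (2 * k + 1) (r j)))) =
      real_of_int (det (mat d d (\<lambda>(k,j). int (ffact (2 * k + 1) (r j)))))"
    by (simp add: det_mat_leibniz)
  show "moment d a r m * (\<Prod>k = 0..<d. fact (2 * k + 1)) =
      fact m * 2 ^ d * alternant d a (\<lambda>k. 2 * k + 1) *
        det (mat d d (\<lambda>(k,j). int (ffact (2 * k + 1) (r j))))" (is "?L = ?R")
    if "m + sum r {0..<d} = d\<^sup>2"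
  proof -
    have "real_of_int ?L = real_of_int ?R"
      using moment_leading[OF W' that]
      unfolding det of_int_moment[symmetric] of_int_alternant[symmetric]
      by (simp only: of_int_mult of_int_prod of_int_fact of_int_power of_int_numeral)
    then show ?thesis by (simp only: of_int_eq_iff)
  qed
qed

text \<open>The conditions make each factor \<open>a i\<close>, \<open>a i - a j\<close>,
  \<open>a i + a j\<close> of the alternant with odd exponents invertible modulo p.\<close>

locale distinct_up_to_sign =
  fixes p d :: nat and a :: "nat \<Rightarrow> int"
  assumes p: "prime p" "odd p"
    and not_dvd: "i < d \<Longrightarrow> \<not> int p dvd a i"
    and not_dvd_diff: "j < i \<Longrightarrow> i < d \<Longrightarrow> \<not> int p dvd a i - a j"
    and not_dvd_add: "j < i \<Longrightarrow> i < d \<Longrightarrow> \<not> int p dvd a i + a j"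
begin

lemma prime_int: "prime (int p)"
  using p by simp

lemma two_power_not_dvd: "\<not> int p dvd 2 ^ n"
proof
  assume "int p dvd 2 ^ n"
  then have "int p dvd int 2" using prime_dvd_power[OF prime_int] by simp
  then have "p dvd 2" by (simp only: int_dvd_int_iff)
  then have "p = 2" using p(1) two_is_prime_nat by (rule primes_dvd_imp_eq[rotated -1])
  then show False using p(2) by simp
qed

text \<open>The residues of all \<open>a i\<close> and \<open>- a i\<close> are 2d distinct nonzero
  ones. The bound keeps the factorials and binomials of the leading coefficient prime to p.\<close>

lemma two_times_less: "2 * d < p"
proof -
  define X where "X = (\<lambda>i. a i mod int p) ` {0..<d}"
  define Y where "Y = (\<lambda>i. (- a i) mod int p) ` {0..<d}"
  have "inj_on (\<lambda>i. a i mod int p) {0..<d}"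
  proof (rule linorder_inj_onI')
    fix i j assume "i \<in> {0..<d}" "j \<in> {0..<d}" "i < j"
    then have "\<not> int p dvd a j - a i" using not_dvd_diff[of i j] by simp
    then show "a i mod int p \<noteq> a j mod int p" by (metis mod_eq_dvd_iff)
  qed
  then have X: "card X = d" by (simp add: X_def card_image)
  have "inj_on (\<lambda>i. (- a i) mod int p) {0..<d}"
  proof (rule linorder_inj_onI')
    fix i j assume "i \<in> {0..<d}" "j \<in> {0..<d}" "i < j"
    then have "\<not> int p dvd - a i - - a j" using not_dvd_diff[of i j] by simp
    then show "(- a i) mod int p \<noteq> (- a j) mod int p" by (metis mod_eq_dvd_iff)
  qed
  then have Y: "card Y = d" by (simp add: Y_def card_image)
  have add: "\<not> int p dvd a i + a j" if "i < d" "j < d" for i j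
  proof (cases i j rule: linorder_cases)
    case less
    then show ?thesis using that not_dvd_add[of i j] by (simp add: add.commute)
  next
    case equal
    have "\<not> int p dvd 2 * a i"
      using that not_dvd[of i] two_power_not_dvd[of 1] by (simp add: prime_dvd_mult_iff[OF prime_int])
    then show ?thesis using equal by simp
  next
    case greater
    then show ?thesis using that not_dvd_add[of j i] by simp
  qed
  have "X \<inter> Y = {}"
    using add by (auto simp: X_def Y_def mod_eq_dvd_iff)
  then have "card (X \<union> Y) = 2 * d"
    using X Y by (subst card_Un_disjoint) (auto simp: X_def Y_def)
  moreover have "X \<union> Y \<subseteq> {1..<int p}"
  proof
    fix x assume "x \<in> X \<union> Y"
    then obtain i where "i < d" "x = a i mod int p \<or> x = (- a i) mod int p"
      by (auto simp: X_def Y_def)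
    then have "x \<noteq> 0" "0 \<le> x" "x < int p"
      using not_dvd[of i] prime_gt_0_nat[OF p(1)] by (auto simp: mod_eq_0_iff_dvd)
    then show "x \<in> {1..<int p}" by simp
  qed
  then have "card (X \<union> Y) \<le> card {1..<int p}" by (intro card_mono) auto
  ultimately show ?thesis using prime_gt_0_nat[OF p(1)] by simp
qed

lemma odd_alternant_not_dvd: "\<not> int p dvd alternant d a (\<lambda>k. 2 * k + 1)"
proof -
  have "\<not> int p dvd (a k)\<^sup>2 - (a l)\<^sup>2" if "l < k" "k < d" for k l
    using not_dvd_diff[OF that] not_dvd_add[OF that]
    by (simp add: power2_eq_square square_diff_square_factored prime_dvd_mult_iff[OF prime_int])
  then show ?thesis
    unfolding alternant_arith_progression
    by (auto simp: prime_dvd_prod_iff[OF _ prime_int] prime_dvd_mult_iff[OF prime_int] not_dvd)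
qed

text \<open>Up to sign this is the weight of the empty set for \<open>bump d 0\<close>, which
  \<open>zero_sum_exists\<close> inverts modulo p.\<close>

lemma vandermonde_not_dvd: "\<not> int p dvd alternant d (\<lambda>i. - a i) (\<lambda>j. j)"
proof -
  have "\<not> int p dvd - a k + a l" if "l < k" "k < d" for k l
    using not_dvd_diff[OF that] by (metis dvd_minus_iff minus_diff_eq uminus_add_conv_diff)
  then show ?thesis
    using alternant_arith_progression[of d "\<lambda>i. - a i" 1 0]
    by (auto simp: prime_dvd_prod_iff[OF _ prime_int])
qed

lemma moment_bump_0:
  assumes "d > 0" "m + q < triangle d"
  shows "moment d a (bump d q) m = 0"
  using odd_alternant_not_dvd sum_bump[OF assms(1), of q] assms(2)
  by (intro moment_int_below) auto

lemma fact_not_dvd: "n < p \<Longrightarrow> \<not> int p dvd fact n"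
  using prime_dvd_fact_iff[of p n] p(1) by (metis linorder_not_less of_nat_dvd_iff of_nat_fact)

lemma fermat_int:
  assumes "\<not> int p dvd x"
  shows "[x ^ (p - 1) = 1] (mod int p)"
proof -
  interpret residues "int p" "residue_ring (int p)"
    using prime_gt_1_nat[OF p(1)] by unfold_locales auto
  have "coprime x (int p)"
    using prime_imp_coprime[OF prime_int assms] by (simp add: coprime_commute)
  from euler_theorem[OF this] show ?thesis by (simp add: totient_prime p(1))
qed

text \<open>In the leading-coefficient identity the powers of 2, the factorials on the right and the
  alternant are prime to p. \<open>hook_coeff_eq\<close> reduces the remaining factor to d + q and a
  binomial coefficient, both settled by d + q < p.\<close>

lemma moment_bump_not_dvd:
  assumes "d > 0" "q \<le> d" "d + q < p" "m + q = triangle d" "m < p"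
  shows "\<not> int p dvd moment d a (bump d q) m"
proof
  assume "int p dvd moment d a (bump d q) m"
  then have "int p dvd moment d a (bump d q) m * (\<Prod>k = 0..<d. fact (2 * k + 1))"
    by simp
  also have "\<dots> = fact m * 2 ^ d * alternant d a (\<lambda>k. 2 * k + 1) *
        ((\<Prod>j = 0..<d - 1. fact j * 2 ^ j) * fact (d - 1 + q) * hook_coeff d q)"
    unfolding det_ffact[OF assms(1), symmetric]
    using odd_alternant_not_dvd sum_bump[OF assms(1), of q] assms(4)
    by (intro moment_int_leading) auto
  finally have "int p dvd hook_coeff d q"
    using odd_alternant_not_dvd two_power_not_dvd fact_not_dvd[of m] fact_not_dvd[of "d - 1 + q"]
      fact_not_dvd assms
    by (auto simp: prime_dvd_prod_iff[OF _ prime_int] prime_dvd_mult_iff[OF prime_int])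
  then have "int p dvd 2 ^ (q + 1) * int d * hook_coeff d q" by simp
  also note hook_coeff_eq[OF assms(1,2)]
  finally have "p dvd d + q \<or> p dvd d choose q"
    using two_power_not_dvd by (simp only: prime_dvd_mult_iff[OF prime_int] int_dvd_int_iff) simp
  moreover have "\<not> p dvd d + q" using assms(1,3) by (auto dest: dvd_imp_le)
  moreover have "\<not> p dvd d choose q"
  proof
    assume "p dvd d choose q"
    then have "p dvd fact q * fact (d - q) * (d choose q)" by simp
    then have "p dvd fact d" by (simp only: binomial_fact_lemma[OF assms(2)])
    then show False using assms(3) by (simp add: prime_dvd_fact_iff[OF p(1)])
  qed
  ultimately show False by blast
qed

text \<open>By linearity the sum is a combination of moments, and only the one at the degree
  survives.\<close>

lemma sum_weight_poly:
  assumes "degree f = n" "lead_coeff f = 1" and zero: "\<And>m. m < n \<Longrightarrow> moment d a r m = 0"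
  shows "(\<Sum>I\<in>Pow {0..<d}. weight d a r I * poly f (signed_sum d a I)) = moment d a r n"
proof -
  have "(\<Sum>I\<in>Pow {0..<d}. weight d a r I * poly f (signed_sum d a I)) =
      (\<Sum>m\<le>n. coeff f m * moment d a r m)"
    unfolding poly_altdef assms(1) moment_def sum_distrib_left
    by (subst sum.swap) (simp add: mult_ac)
  also have "\<dots> = (\<Sum>m\<in>{n}. coeff f m * moment d a r m)"
    by (intro sum.mono_neutral_right) (auto simp: zero)
  finally show ?thesis using assms by simp
qed

text \<open>Adding the full sum doubles the chosen terms and cancels the others.\<close>

lemma signed_sum_eq:
  assumes "I \<subseteq> {0..<d}"
  shows "signed_sum d a I = 2 * sum a I - sum a {0..<d}"
proof -
  have "signed_sum d a I + sum a {0..<d} = (\<Sum>i = 0..<d. if i \<in> I then 2 * a i else 0)"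
    unfolding signed_sum_def sum.distrib[symmetric]
    by (rule sum.cong) (auto simp: sign_of_def)
  also have "\<dots> = 2 * sum a I"
    using assms by (simp add: sum_distrib_left Int_absorb1 flip: sum.inter_restrict)
  finally show ?thesis by simp
qed

lemma card_subset_sums:
  assumes "triangle d < p"
  shows "triangle d + 1 \<le> card ((\<lambda>I. sum a I mod int p) ` Pow {0..<d})"
proof (cases "d = 0")
  case True
  then show ?thesis by (simp add: triangle_def)
next
  case False
  define V where "V = (\<lambda>I. signed_sum d a I mod int p) ` Pow {0..<d}"
  have two_mod: "(2 * x - y) mod int p = (2 * (x mod int p) - y) mod int p" for x y
    by (metis mod_diff_left_eq mod_mult_right_eq)
  have "V = (\<lambda>s. (2 * s - sum a {0..<d}) mod int p) ` (\<lambda>I. sum a I mod int p) ` Pow {0..<d}"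
    unfolding V_def image_image
  proof (rule image_cong[OF refl])
    fix I assume "I \<in> Pow {0..<d}"
    then have "signed_sum d a I = 2 * sum a I - sum a {0..<d}" by (simp add: signed_sum_eq)
    then show "signed_sum d a I mod int p = (2 * (sum a I mod int p) - sum a {0..<d}) mod int p"
      by (rule ssubst) (rule two_mod)
  qed
  then have "card V \<le> card ((\<lambda>I. sum a I mod int p) ` Pow {0..<d})"
    by (simp add: card_image_le)
  moreover have "triangle d < card V"
  proof (rule ccontr)
    assume "\<not> triangle d < card V"
    then have le: "card V \<le> triangle d" by simp
    have fin: "finite V" by (simp add: V_def)
    \<comment> \<open>The monomial pads the degree to exactly \<open>triangle d\<close>, the index
      of the leading moment.\<close>
    define f where "f = monom 1 (triangle d - card V) * (\<Prod>c\<in>V. [:- c, 1:])"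
    define P where "P = (\<Prod>c\<in>V. [:- c, 1:])"
    have "degree P = card V"
      unfolding P_def by (subst degree_prod_eq_sum_degree) auto
    moreover have P: "lead_coeff P = 1"
      unfolding P_def by (simp add: lead_coeff_prod)
    moreover from P have "P \<noteq> 0" by (metis coeff_0 zero_neq_one)
    moreover have f_P: "f = monom 1 (triangle d - card V) * P" by (simp add: f_def P_def)
    ultimately have deg: "degree f = triangle d"
      using le by (simp add: degree_mult_eq degree_monom_eq)
    have "lead_coeff f = 1"
      unfolding f_P lead_coeff_mult P by (simp add: degree_monom_eq)
    note f = deg this
    have "int p dvd (\<Sum>I\<in>Pow {0..<d}. weight d a (bump d 0) I * poly f (signed_sum d a I))"
    proof (rule dvd_sum)
      fix I assume "I \<in> Pow {0..<d}"
      then have "signed_sum d a I mod int p \<in> V" by (simp add: V_def)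
      then have "poly [:- (signed_sum d a I mod int p), 1:] (signed_sum d a I) dvd
          (\<Prod>c\<in>V. poly [:- c, 1:] (signed_sum d a I))"
        by (intro dvd_prodI[OF fin, of _ "\<lambda>c. poly [:- c, 1:] (signed_sum d a I)"])
      then have "signed_sum d a I - signed_sum d a I mod int p dvd poly f (signed_sum d a I)"
        unfolding f_def poly_mult poly_prod by (intro dvd_mult) simp
      then have "int p dvd poly f (signed_sum d a I)"
        by (rule dvd_trans[rotated]) (simp add: minus_mod_eq_mult_div)
      then show "int p dvd weight d a (bump d 0) I * poly f (signed_sum d a I)" by simp
    qed
    also have "\<dots> = moment d a (bump d 0) (triangle d)"
      using False by (intro sum_weight_poly f moment_bump_0) auto
    finally show False
      using moment_bump_not_dvd[of 0 "triangle d"] False assms two_times_less by simp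
  qed
  ultimately show ?thesis by simp
qed

lemma weight_empty: "weight d a r {} = (- 1) ^ d * alternant d (\<lambda>i. - a i) r"
  by (simp add: weight_def sign_of_def)

text \<open>
  The polynomial \<open>(x + \<sigma>) ^ (p - 1) - 1\<close> vanishes mod \<open>p\<close> at every signed sum except the one of the
  empty set, if there is no nonempty zero sum. The combination of weights for the exponents
  \<open>bump d q\<close> and \<open>bump d 0\<close> is chosen to vanish at the empty set.
\<close>

lemma zero_sum_exists:
  assumes "p \<le> triangle d" "triangle d < p + d"
  shows "\<exists>I \<subseteq> {0..<d}. I \<noteq> {} \<and> int p dvd sum a I"
proof (rule ccontr)
  assume free: "\<not> ?thesis"
  \<comment> \<open>With this q the leading moment for \<open>bump d q\<close> has index p - 1, the
    degree of \<open>f\<close>; the assumptions give 0 < q \<le> d.\<close>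
  define q where "q = triangle d - (p - 1)"
  have p1: "p > 1" using p prime_gt_1_nat by blast
  have d: "d > 0" using assms by auto
  have q: "q > 0" "q \<le> d" "p - 1 + q = triangle d" using assms p1 by (auto simp: q_def)
  define \<sigma> where "\<sigma> = sum a {0..<d}"
  define f where "f = [:\<sigma>, 1:] ^ (p - 1) - 1"
  have "degree ([:\<sigma>, 1:] ^ (p - 1)) = p - 1" by (simp add: degree_power_eq)
  then have deg: "degree f = p - 1"
    using p1 degree_add_eq_left[of "- 1" "[:\<sigma>, 1:] ^ (p - 1)"] unfolding f_def by simp
  have f: "degree f = p - 1" "lead_coeff f = 1"
    using p1 unfolding deg unfolding f_def by (auto simp: coeff_linear_power)
  have "coprime (weight d a (bump d 0) {}) (int p)"
    using vandermonde_not_dvd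
    by (intro prime_imp_coprime[OF prime_int, THEN coprime_commute[THEN iffD1]])
       (simp add: weight_empty bump_0 minus_one_power_iff)
  \<comment> \<open>\<open>u\<close> inverts the weight of the empty set for
    \<open>bump d 0\<close>, so the \<open>c\<close> below is the ratio of the two weights
    there.\<close>
  then obtain u where "[weight d a (bump d 0) {} * u = 1] (mod int p)"
    using cong_solve_coprime_int by blast
  then have "[weight d a (bump d 0) {} * u * weight d a (bump d q) {} = 1 * weight d a (bump d q) {}] (mod int p)"
    by (rule cong_scalar_right)
  then have "int p dvd weight d a (bump d 0) {} * u * weight d a (bump d q) {} - weight d a (bump d q) {}"
    by (simp add: cong_iff_dvd_diff)
  moreover define c where "c = u * weight d a (bump d q) {}"
  ultimately have c: "int p dvd weight d a (bump d q) {} - c * weight d a (bump d 0) {}"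
    by (subst dvd_diff_commute) (simp add: mult_ac)
  have "int p dvd (\<Sum>I\<in>Pow {0..<d}. (weight d a (bump d q) I - c * weight d a (bump d 0) I) *
      poly f (signed_sum d a I))"
  proof (rule dvd_sum)
    fix I assume I: "I \<in> Pow {0..<d}"
    show "int p dvd (weight d a (bump d q) I - c * weight d a (bump d 0) I) * poly f (signed_sum d a I)"
    proof (cases "I = {}")
      case False
      have "\<not> int p dvd 2 * sum a I"
        using False I free two_power_not_dvd[of 1] by (auto simp: prime_dvd_mult_iff[OF prime_int])
      then have "[(2 * sum a I) ^ (p - 1) = 1] (mod int p)"
        by (rule fermat_int)
      moreover have "poly f (signed_sum d a I) = (2 * sum a I) ^ (p - 1) - 1"
        using I by (simp add: f_def poly_power signed_sum_eq \<sigma>_def)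
      ultimately show ?thesis by (simp add: cong_iff_dvd_diff)
    qed (use c in simp)
  qed
  also have "\<dots> = (\<Sum>I\<in>Pow {0..<d}. weight d a (bump d q) I * poly f (signed_sum d a I)) -
      c * (\<Sum>I\<in>Pow {0..<d}. weight d a (bump d 0) I * poly f (signed_sum d a I))"
    by (simp add: sum_subtractf sum_distrib_left algebra_simps)
  also have "\<dots> = moment d a (bump d q) (p - 1) - c * moment d a (bump d 0) (p - 1)"
    using d q
    by (intro arg_cong2[of _ _ _ _ "\<lambda>x y. x - c * y"] sum_weight_poly f moment_bump_0) auto
  \<comment> \<open>Without the raised exponent the leading index is \<open>triangle d\<close> > p -
    1.\<close>
  also have "moment d a (bump d 0) (p - 1) = 0"
    using d q by (intro moment_bump_0) auto
  finally show False
    using moment_bump_not_dvd[of q "p - 1"] d q assms p1 two_times_less by simp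
qed

end

section \<open>The Cauchy-Davenport theorem\<close>

definition sumset :: "nat \<Rightarrow> int set \<Rightarrow> int set \<Rightarrow> int set" where
  "sumset p A B = {(x + y) mod int p | x y. x \<in> A \<and> y \<in> B}"

lemma sumset_subset: "p > 0 \<Longrightarrow> sumset p A B \<subseteq> {0..<int p}"
  by (auto simp: sumset_def)

lemma inj_on_translate_mod: "inj_on (\<lambda>x. (x + e) mod int p) {0..<int p}"
proof (rule inj_onI)
  fix x y assume "x \<in> {0..<int p}" "y \<in> {0..<int p}" "(x + e) mod int p = (y + e) mod int p"
  then have "int p dvd (x + e) - (y + e)" by (simp only: mod_eq_dvd_iff)
  then have "x mod int p = y mod int p" by (simp only: mod_eq_dvd_iff) simp
  with \<open>x \<in> _\<close> \<open>y \<in> _\<close> show "x = y" by (metis atLeastLessThan_iff mod_pos_pos_trivial)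
qed

lemma card_le_sumset:
  assumes "A \<subseteq> {0..<int p}" "b \<in> B" "p > 0"
  shows "card A \<le> card (sumset p A B)"
proof -
  have "card A = card ((\<lambda>x. (x + b) mod int p) ` A)"
    using inj_on_subset[OF inj_on_translate_mod assms(1)] by (simp add: card_image)
  also have "\<dots> \<le> card (sumset p A B)"
    using assms sumset_subset[OF assms(3), of A B]
    by (intro card_mono) (auto simp: sumset_def intro: finite_subset)
  finally show ?thesis .
qed

text \<open>A nonzero \<open>t\<close> generates the additive group: y is reached from x in (y - x)
  / t steps, the quotient taken modulo p.\<close>

lemma translation_closed_imp_full:
  assumes "prime p" "A \<subseteq> {0..<int p}" "x \<in> A" "\<not> int p dvd t"
    and closed: "\<And>a. a \<in> A \<Longrightarrow> (a + t) mod int p \<in> A"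
  shows "A = {0..<int p}"
proof
  show "{0..<int p} \<subseteq> A"
  proof
    fix y assume y: "y \<in> {0..<int p}"
    have step: "(x + int n * t) mod int p \<in> A" for n
    proof (induction n)
      case (Suc n)
      from closed[OF this] show ?case by (simp add: algebra_simps mod_simps)
    qed (use assms in auto)
    have "coprime t (int p)"
      using prime_imp_coprime[of "int p" t] assms by (simp add: coprime_commute)
    then obtain u where "[t * u = 1] (mod int p)" using cong_solve_coprime_int by blast
    then have u: "[t * u * (y - x) = 1 * (y - x)] (mod int p)" by (rule cong_scalar_right)
    define n where "n = nat (u * (y - x) mod int p)"
    have "int n = u * (y - x) mod int p"
      using prime_gt_0_nat[OF assms(1)] by (simp add: n_def)
    then have "(x + int n * t) mod int p = (x + u * (y - x) * t) mod int p"
      by (metis mod_add_right_eq mod_mult_left_eq)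
    also have "u * (y - x) * t = t * u * (y - x)" by (simp only: mult_ac)
    also have "(x + t * u * (y - x)) mod int p = (x + (y - x)) mod int p"
      using u by (metis cong_def mod_add_right_eq mult_1)
    finally show "y \<in> A" using step[of n] y by simp
  qed
qed (use assms in auto)

text \<open>Induction on the size of \<open>B\<close> by the Dyson transform, which replaces \<open>(A, B)\<close> by
  \<open>(A \<union> (B + e), B \<inter> (A - e))\<close>.\<close>

lemma cauchy_davenport:
  assumes "prime p" "A \<subseteq> {0..<int p}" "B \<subseteq> {0..<int p}" "A \<noteq> {}" "B \<noteq> {}"
  shows "min p (card A + card B - 1) \<le> card (sumset p A B)"
  using assms(2-5)
proof (induction "card B" arbitrary: A B rule: less_induct)
  case less
  have p: "p > 0" using assms(1) prime_gt_0_nat by blast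
  have fin: "finite A" "finite B" using less.prems by (auto intro: finite_subset)
  obtain b where b: "b \<in> B" using less.prems by blast
  show ?case
  proof (cases "A = {0..<int p} \<or> B = {b}")
    case True
    then show ?thesis using card_le_sumset[OF less.prems(1) b p] by auto
  next
    case False
    then obtain b' where b': "b' \<in> B" "b' \<noteq> b" using b by blast
    have "\<not> int p dvd b' - b"
    proof
      assume "int p dvd b' - b"
      then have "b' mod int p = b mod int p" by (simp add: mod_eq_dvd_iff)
      then show False using b b' less.prems by (auto simp: subset_iff)
    qed
    \<comment> \<open>Translation by b' - b moves some \<open>a\<close> out of A. The shift e = a -
      b then keeps b in B' and removes b', so B' is nonempty and smaller than B.\<close>
    then obtain a where a: "a \<in> A" "(a + (b' - b)) mod int p \<notin> A"
      using translation_closed_imp_full[OF assms(1) less.prems(1)] False less.prems(3) by blast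
    define e where "e = a - b"
    define T where "T = (\<lambda>y. (y + e) mod int p)"
    define A' where "A' = A \<union> T ` B"
    define B' where "B' = {y \<in> B. T y \<in> A}"
    have "T b = a" using a less.prems by (auto simp: T_def e_def subset_iff)
    then have bB: "b \<in> B'" using a b by (simp add: B'_def)
    have "T b' \<notin> A" using a(2) by (simp add: T_def e_def algebra_simps)
    then have "B' \<subset> B" using b' by (auto simp: B'_def)
    then have smaller: "card B' < card B" using fin by (simp add: psubset_card_mono)
    have inj: "inj_on T B" unfolding T_def
      by (rule inj_on_subset[OF inj_on_translate_mod less.prems(2)])
    have "card (T ` B') = card B'"
      using inj by (intro card_image) (auto intro: inj_on_subset simp: B'_def)
    moreover have "T ` B' = A \<inter> T ` B" by (auto simp: B'_def)
    moreover have "card (T ` B) = card B" using inj by (rule card_image)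
    ultimately have "card A' + card B' = card A + card B"
      using card_Un_Int[of A "T ` B"] fin by (simp add: A'_def)
    moreover have "min p (card A' + card B' - 1) \<le> card (sumset p A' B')"
      using less.prems p bB a by (intro less.hyps[OF smaller]) (auto simp: A'_def B'_def T_def)
    moreover have "sumset p A' B' \<subseteq> sumset p A B"
    proof
      fix z assume "z \<in> sumset p A' B'"
      then obtain x y where z: "z = (x + y) mod int p" "x \<in> A'" "y \<in> B'"
        by (auto simp: sumset_def)
      show "z \<in> sumset p A B"
      proof (cases "x \<in> A")
        case True
        then show ?thesis using z by (auto simp: sumset_def B'_def)
      next
        case False
        then obtain w where w: "w \<in> B" "x = T w" using z by (auto simp: A'_def)
        \<comment> \<open>The shift e moves from w to y: (w + e) + y = (y + e) + w, and y + e lies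
          in A.\<close>
        have "z = (T y + w) mod int p"
          unfolding z w T_def by (simp add: mod_simps algebra_simps)
        then show ?thesis using z w by (auto simp: sumset_def B'_def)
      qed
    qed
    then have "card (sumset p A' B') \<le> card (sumset p A B)"
      using sumset_subset[OF p, of A B] by (intro card_mono) (auto intro: finite_subset)
    ultimately show ?thesis by simp
  qed
qed

section \<open>Subset sums of a union of sets\<close>

definition subset_sums :: "nat \<Rightarrow> (nat \<Rightarrow> int) \<Rightarrow> nat set \<Rightarrow> int set" where
  "subset_sums p s J = (\<lambda>I. sum s I mod int p) ` Pow J"

definition free_on :: "nat \<Rightarrow> (nat \<Rightarrow> int) \<Rightarrow> nat set \<Rightarrow> bool" where
  "free_on p s J \<longleftrightarrow> (\<forall>I \<subseteq> J. I \<noteq> {} \<longrightarrow> \<not> int p dvd sum s I)"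

lemma free_on_subset: "free_on p s J \<Longrightarrow> K \<subseteq> J \<Longrightarrow> free_on p s K"
  unfolding free_on_def by blast

lemma triangle_Suc: "triangle (Suc n) = triangle n + Suc n"
  by (simp add: triangle_def)

text \<open>Zero-sum freeness for singletons and pairs excludes zero entries and opposite
  entries.\<close>

lemma free_on_distinct_up_to_sign:
  assumes "prime p" "odd p" "free_on p a {0..<d}"
    and inj: "\<And>i j. j < i \<Longrightarrow> i < d \<Longrightarrow> \<not> int p dvd a i - a j"
  shows "distinct_up_to_sign p d a"
proof
  show "\<not> int p dvd a i" if "i < d" for i
    using assms(3) that unfolding free_on_def by (auto dest!: spec[of _ "{i}"])
  show "\<not> int p dvd a i + a j" if "j < i" "i < d" for i j
    using assms(3) that unfolding free_on_def by (auto dest!: spec[of _ "{i, j}"])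
qed (use assms in auto)

text \<open>Otherwise take the shortest prefix, of length e, with p \<le> \<open>triangle e\<close>.
  Minimality gives \<open>triangle e\<close> < p + e, the range in which
  \<open>zero_sum_exists\<close> produces a zero sum.\<close>

lemma triangle_less:
  assumes "prime p" "odd p" "free_on p a {0..<d}"
    and inj: "\<And>i j. j < i \<Longrightarrow> i < d \<Longrightarrow> \<not> int p dvd a i - a j"
  shows "triangle d < p"
proof (rule ccontr)
  assume large: "\<not> triangle d < p"
  define e where "e = (LEAST e. p \<le> triangle e)"
  have e: "p \<le> triangle e" "e \<le> d"
    unfolding e_def using large
    by (auto intro!: LeastI[of "\<lambda>e. p \<le> triangle e" d] Least_le)
  have "e \<noteq> 0" using e prime_gt_0_nat[OF assms(1)] by (auto simp: triangle_def intro: ccontr)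
  then obtain e' where e': "e = Suc e'" by (cases e) auto
  then have "\<not> p \<le> triangle e'" unfolding e_def by (intro not_less_Least) (auto simp: e_def)
  then have "triangle e < p + e" by (simp add: e' triangle_Suc)
  moreover have free: "free_on p a {0..<e}" using assms(3) e by (auto intro: free_on_subset)
  moreover have "distinct_up_to_sign p e a"
    using free e assms by (intro free_on_distinct_up_to_sign) auto
  ultimately show False
    using distinct_up_to_sign.zero_sum_exists[of p e a] e unfolding free_on_def by blast
qed

lemma card_subset_sums_distinct:
  assumes "prime p" "odd p" "finite J" "free_on p s J"
    and inj: "inj_on (\<lambda>i. s i mod int p) J"
  shows "triangle (card J) + 1 \<le> card (subset_sums p s J)"
proof -
  obtain h where h: "bij_betw h {0..<card J} J"
    using ex_bij_betw_nat_finite[OF assms(3)] by blast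
  let ?d = "card J" and ?a = "s \<circ> h"
  have sum: "sum ?a I = sum s (h ` I)" if "I \<subseteq> {0..<?d}" for I
    using h that by (subst sum.reindex) (auto simp: bij_betw_def intro: inj_on_subset)
  have free: "free_on p ?a {0..<?d}"
    unfolding free_on_def
  proof (intro allI impI)
    fix I assume I: "I \<subseteq> {0..<?d}" "I \<noteq> {}"
    then have "h ` I \<subseteq> J" "h ` I \<noteq> {}" using h unfolding bij_betw_def by auto
    then show "\<not> int p dvd sum ?a I"
      using assms(4) unfolding free_on_def sum[OF I(1)] by blast
  qed
  have distinct: "\<not> int p dvd ?a i - ?a j" if "j < i" "i < ?d" for i j
  proof
    assume "int p dvd ?a i - ?a j"
    then have "s (h i) mod int p = s (h j) mod int p" by (simp add: mod_eq_dvd_iff)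
    moreover have "h i \<in> J" "h j \<in> J" using h that by (auto simp: bij_betw_def)
    ultimately have "h i = h j" using inj by (auto dest: inj_onD)
    then show False using h that by (auto simp: bij_betw_def dest: inj_onD)
  qed
  interpret distinct_up_to_sign p ?d ?a
    using assms free distinct by (intro free_on_distinct_up_to_sign) auto
  have "subset_sums p s J = (\<lambda>I. sum s I mod int p) ` Pow (h ` {0..<?d})"
    using h by (simp add: subset_sums_def bij_betw_def)
  also have "\<dots> = (\<lambda>I. sum ?a I mod int p) ` Pow {0..<?d}"
    unfolding image_Pow_surj[OF refl, symmetric] image_image
    by (rule image_cong) (auto simp: sum simp del: o_apply)
  finally show ?thesis
    using card_subset_sums triangle_less[OF assms(1,2) free distinct] by simp
qed

text \<open>Cauchy-Davenport adds one class at a time. The bound by p, proved alongside, removes the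
  minimum with p from its conclusion.\<close>

lemma card_subset_sums_partition:
  fixes f :: "nat \<Rightarrow> nat" and h :: nat
  assumes "prime p" "odd p" "finite U" "free_on p s U"
    and "\<forall>j<h. inj_on (\<lambda>i. s i mod int p) {i \<in> U. f i = j}"
    and "\<forall>i\<in>U. f i < h"
  shows "(\<Sum>j<h. triangle (card {i \<in> U. f i = j})) + 1 \<le> card (subset_sums p s U) \<and>
    (\<Sum>j<h. triangle (card {i \<in> U. f i = j})) < p"
  using assms(3-)
proof (induction h arbitrary: U)
  case 0
  then have "U = {}" by auto
  then show ?case using prime_gt_0_nat[OF assms(1)] by (simp add: subset_sums_def)
next
  case (Suc h)
  have p: "p > 0" using assms(1) prime_gt_0_nat by blast
  define J where "J = {i \<in> U. f i = h}"
  define V where "V = {i \<in> U. f i < h}"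
  have UV: "U = J \<union> V" "J \<inter> V = {}"
    using Suc.prems(4) by (auto simp: J_def V_def less_Suc_eq)
  have sub_U: "J \<subseteq> U" "V \<subseteq> U" by (auto simp: J_def V_def)
  have fin: "finite J" "finite V" using Suc.prems(1) by (auto simp: J_def V_def)
  have V_class: "{i \<in> V. f i = j} = {i \<in> U. f i = j}" if "j < h" for j
    using that by (auto simp: V_def)
  define M where "M = (\<Sum>j<h. triangle (card {i \<in> V. f i = j}))"
  have IH: "M + 1 \<le> card (subset_sums p s V)"
    unfolding M_def
    using Suc.prems(2-4) free_on_subset[of p s U V] sub_U fin
    by (intro Suc.IH[THEN conjunct1]) (simp_all add: V_class, simp add: V_def)
  have total: "(\<Sum>j<Suc h. triangle (card {i \<in> U. f i = j})) = M + triangle (card J)"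
    unfolding M_def by (simp add: V_class J_def)
  have J: "triangle (card J) + 1 \<le> card (subset_sums p s J)"
    using Suc.prems(2,3) free_on_subset[of p s U J] sub_U fin
    by (intro card_subset_sums_distinct assms(1,2)) (simp_all, simp add: J_def)
  have range: "subset_sums p s K \<subseteq> {0..<int p}" for K
    using p by (auto simp: subset_sums_def)
  have ne: "0 \<in> subset_sums p s K" for K
    by (auto simp: subset_sums_def intro!: image_eqI[of _ _ "{}"])
  have split: "sum s (I \<union> I') = sum s I + sum s I'" if "I \<subseteq> J" "I' \<subseteq> V" for I I'
    using that fin UV(2) by (intro sum.union_disjoint) (auto intro: finite_subset)
  have sub: "sumset p (subset_sums p s J) (subset_sums p s V) \<subseteq> subset_sums p s U"
  proof
    fix z assume "z \<in> sumset p (subset_sums p s J) (subset_sums p s V)"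
    then obtain I I' where I: "I \<subseteq> J" "I' \<subseteq> V" "z = (sum s I mod int p + sum s I' mod int p) mod int p"
      by (auto simp: sumset_def subset_sums_def)
    then have "z = sum s (I \<union> I') mod int p" by (simp add: split mod_simps)
    then show "z \<in> subset_sums p s U" using I UV by (auto simp: subset_sums_def)
  qed
  have bound: "M + triangle (card J) < p"
  proof (cases "J = {}")
    case True
    have "card (subset_sums p s V) \<le> card {0..<int p}" by (intro card_mono range) simp
    then show ?thesis using True IH by (simp add: triangle_def)
  next
    case False
    \<comment> \<open>With 0 deleted, every element of the sumset is the sum of a nonempty subset of
      U, hence nonzero. So the sumset has at most p - 1 elements, which gives the strict
      bound.\<close>
    let ?X = "subset_sums p s J - {0}"
    have X: "triangle (card J) \<le> card ?X" using J ne[of J] by simp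
    have "card J > 0" using False fin by (simp add: card_gt_0_iff)
    then have "triangle (card J) > 0" by (cases "card J") (auto simp: triangle_Suc)
    then have "?X \<noteq> {}" using X by (metis card.empty not_less0 order_less_le_trans)
    then have "min p (card ?X + card (subset_sums p s V) - 1) \<le> card (sumset p ?X (subset_sums p s V))"
      using range ne[of V] by (intro cauchy_davenport assms(1)) auto
    also have "\<dots> \<le> card {1..<int p}"
    proof (rule card_mono)
      show "sumset p ?X (subset_sums p s V) \<subseteq> {1..<int p}"
      proof
        fix z assume z: "z \<in> sumset p ?X (subset_sums p s V)"
        then obtain I I' where I: "I \<subseteq> J" "I' \<subseteq> V" "sum s I mod int p \<noteq> 0"
            "z = (sum s I mod int p + sum s I' mod int p) mod int p"
          by (auto simp: sumset_def subset_sums_def)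
        then have "z = sum s (I \<union> I') mod int p" by (simp add: split mod_simps)
        moreover have "I \<union> I' \<noteq> {}" "I \<union> I' \<subseteq> U" using I UV by auto
        then have "\<not> int p dvd sum s (I \<union> I')" using Suc.prems(2) unfolding free_on_def by blast
        ultimately have "z \<noteq> 0" by (simp add: mod_eq_0_iff_dvd)
        moreover have "z \<in> {0..<int p}" using z sumset_subset[OF p] by blast
        ultimately show "z \<in> {1..<int p}" by simp
      qed
    qed simp
    finally have "min p (card ?X + card (subset_sums p s V) - 1) \<le> p - 1" by simp
    then show ?thesis using X IH p by linarith
  qed
  have "min p (card (subset_sums p s J) + card (subset_sums p s V) - 1) \<le>
      card (sumset p (subset_sums p s J) (subset_sums p s V))"
    using range ne by (intro cauchy_davenport assms(1)) blast+
  also have "\<dots> \<le> card (subset_sums p s U)"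
    using sub range by (intro card_mono) (auto intro: finite_subset)
  finally have "min p (card (subset_sums p s J) + card (subset_sums p s V) - 1) \<le>
      card (subset_sums p s U)" .
  then show ?case using bound IH J unfolding total by linarith
qed

section \<open>Zero-sum free sequences\<close>

lemma zero_sum_free_imp_free_on:
  assumes "p > 1" "set S \<subseteq> carrier (residue_ring (int p))" "zero_sum_free (residue_ring (int p)) S"
  shows "free_on p (\<lambda>i. S ! i) {..<length S}"
  unfolding free_on_def
proof (intro allI impI notI)
  fix I assume I: "I \<subseteq> {..<length S}" "I \<noteq> {}" "int p dvd (\<Sum>i\<in>I. S ! i)"
  interpret residues "int p" "residue_ring (int p)"
    using assms(1) by unfold_locales auto
  have "S ! i mod int p = S ! i" if "i \<in> I" for i
  proof -
    have "S ! i \<in> carrier (residue_ring (int p))" using that I(1) by (intro subsetD[OF assms(2)] nth_mem) auto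
    then show ?thesis by (simp add: res_carrier_eq)
  qed
  then have "(\<Oplus>\<^bsub>residue_ring (int p)\<^esub>i\<in>I. S ! i) = (\<Oplus>\<^bsub>residue_ring (int p)\<^esub>i\<in>I. S ! i mod int p)"
    by (intro finsum_cong') (auto)
  also have "\<dots> = (\<Sum>i\<in>I. S ! i) mod int p"
    using I(1) by (intro sum_cong) (auto intro: finite_subset)
  also have "\<dots> = \<zero>\<^bsub>residue_ring (int p)\<^esub>" using I(3) by (simp add: res_zero_eq)
  finally have z: "(\<Oplus>\<^bsub>residue_ring (int p)\<^esub>i\<in>I. S ! i) = \<zero>\<^bsub>residue_ring (int p)\<^esub>" .
  show False using assms(3) I z[symmetric] unfolding zero_sum_free_def by blast
qed

text \<open>Ranks among equal entries therefore strictly increase: they differ for different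
  positions and stay below the multiplicity.\<close>

lemma count_list_take_strict_mono:
  assumes "i < j" "j \<le> length S" "S ! i = x"
  shows "count_list (take i S) x < count_list (take j S) x"
proof -
  have "take j S = take i S @ S ! i # take (j - Suc i) (drop (Suc i) S)"
    using assms id_take_nth_drop[of i "take j S"] by (simp add: min_def drop_take)
  then show ?thesis using assms(3) by simp
qed

lemma two_times_triangle: "2 * triangle n = n * (n + 1)"
  by (simp add: triangle_def)

text \<open>The difference is half a product of two consecutive integers; equality holds at n = k
  and n = k + 1.\<close>

lemma triangle_tangent: "int (k + 1) * int n \<le> int (triangle n) + int (triangle k)"
proof -
  have "2 * (int (triangle n) + int (triangle k) - int (k + 1) * int n) = (int n - int k) * (int n - int k - 1)"
    using arg_cong[OF two_times_triangle[of n], of int] arg_cong[OF two_times_triangle[of k], of int]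
    by (simp add: algebra_simps)
  moreover have "0 \<le> (int n - int k) * (int n - int k - 1)"
    by (cases "int n - int k \<ge> 1") (auto intro!: mult_nonneg_nonneg mult_nonpos_nonpos)
  ultimately show ?thesis by simp
qed

theorem theorem7:
  fixes p :: nat and S :: "int list" and k :: nat
  assumes "prime p" and "odd p"
    and "set S \<subseteq> carrier (residue_ring (int p))"
    and "S \<noteq> []"
    and "zero_sum_free (residue_ring (int p)) S"
    and "k > 0"
  shows "\<exists>x\<in>set S. int (count_list S x) \<ge>
           \<lceil>2 / real k * real (length S) - 2 / (real k * (real k + 1)) * (real p - 1)\<rceil>"
proof -
  have p: "p > 1" using assms(1) prime_gt_1_nat by blast
  define h where "h = Max (count_list S ` set S)"
  have "h \<in> count_list S ` set S" unfolding h_def using assms(4) by (intro Max_in) auto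
  then obtain x where x: "x \<in> set S" "count_list S x = h" by auto
  \<comment> \<open>The rank of position i counts the earlier equal entries, so each class contains
    a value at most once and there are h ranks.\<close>
  define f where "f i = count_list (take i S) (S ! i)" for i
  define C where "C j = {i \<in> {..<length S}. f i = j}" for j
  have f: "f i < h" if "i \<in> {..<length S}" for i
  proof -
    have "f i < count_list (take (length S) S) (S ! i)"
      unfolding f_def using that by (intro count_list_take_strict_mono) auto
    also have "\<dots> \<le> h" using that by (auto simp: h_def)
    finally show ?thesis .
  qed
  have inj: "inj_on (\<lambda>i. S ! i mod int p) (C j)" for j
  proof (rule inj_onI)
    fix i i' assume i: "i \<in> C j" "i' \<in> C j" "S ! i mod int p = S ! i' mod int p"
    have "0 \<le> S ! l \<and> S ! l < int p" if "l \<in> C j" for l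
    proof -
      have "S ! l \<in> carrier (residue_ring (int p))" using that by (intro subsetD[OF assms(3)] nth_mem) (auto simp: C_def)
      then show ?thesis by (simp add: residue_ring_def)
    qed
    then have "S ! i = S ! i'" using i by simp
    then show "i = i'"
      using i count_list_take_strict_mono[of i i' S "S ! i"] count_list_take_strict_mono[of i' i S "S ! i"]
      by (cases i i' rule: linorder_cases) (auto simp: C_def f_def)
  qed
  have bound: "(\<Sum>j<h. triangle (card (C j))) < p"
    using card_subset_sums_partition[OF assms(1,2) _ zero_sum_free_imp_free_on[OF p assms(3,5)], of h f]
      inj f unfolding C_def by blast
  have "length S = (\<Sum>j<h. card (C j))"
  proof -
    have "card {..<length S} = card (\<Union>j<h. C j)"
      using f by (intro arg_cong[of _ _ card]) (auto simp: C_def)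
    also have "\<dots> = (\<Sum>j<h. card (C j))"
      by (rule card_UN_disjoint) (auto simp: C_def)
    finally show ?thesis by simp
  qed
  then have "int (k + 1) * int (length S) = (\<Sum>j<h. int (k + 1) * int (card (C j)))"
    by (simp add: sum_distrib_left)
  also have "\<dots> \<le> (\<Sum>j<h. int (triangle (card (C j))) + int (triangle k))"
    by (intro sum_mono triangle_tangent)
  also have "\<dots> = int (\<Sum>j<h. triangle (card (C j))) + int h * int (triangle k)"
    by (simp add: sum.distrib)
  finally have "real_of_int (int (k + 1) * int (length S)) \<le> real_of_int (int p - 1 + int h * int (triangle k))"
    using bound by linarith
  moreover have "real h * (real k * (real k + 1)) = 2 * (real h * real (triangle k))"
    using arg_cong[OF two_times_triangle[of k], of real] by (simp add: algebra_simps)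
  ultimately have "2 * ((real k + 1) * real (length S)) \<le> 2 * (real p - 1) + real h * (real k * (real k + 1))"
    by (simp add: algebra_simps)
  then have "2 / real k * real (length S) - 2 / (real k * (real k + 1)) * (real p - 1) \<le> real h"
  proof -
    have "2 / real k * real (length S) = 2 * ((real k + 1) * real (length S)) / (real k * (real k + 1))"
      using assms(6) by (simp add: add_eq_0_iff divide_simps)
    then have "2 / real k * real (length S) - 2 / (real k * (real k + 1)) * (real p - 1) =
        (2 * ((real k + 1) * real (length S)) - 2 * (real p - 1)) / (real k * (real k + 1))"
      by (simp add: diff_divide_distrib)
    also have "\<dots> \<le> real h"
      using \<open>2 * ((real k + 1) * real (length S)) \<le> _\<close> assms(6)
      by (subst pos_divide_le_eq) (auto intro!: mult_pos_pos)
    finally show ?thesis .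
  qed
  \<comment> \<open>Since h is an integer, the bound passes to the ceiling.\<close>
  then have "\<lceil>2 / real k * real (length S) - 2 / (real k * (real k + 1)) * (real p - 1)\<rceil> \<le> int h"
    by (simp add: ceiling_le_iff)
  then show ?thesis using x by auto
qed

end
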